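(* Let $\Gamma$ be a finitely generated group admitting a topologically free extreme boundary action on a compact Hausdorff space with more than two points. Then $\operatorname{Gir}(\Gamma)=\infty$.
   Context: Girth: for a finitely generated group $\Gamma$ and a finite generating set $S$, consider words in the formal alphabet $S^{\pm1}$. A word is reduced if no letter is immediately followed by its formal inverse, and cyclically reduced if, in addition, the first and last letters are not formal inverses. $\operatorname{Gir}(\Gamma,S)$ is the smallest length of a nonempty cyclically reduced word representing the identity of $\Gamma$, with $\operatorname{Gir}(\Gamma,S)=\infty$ if no such word exists; $\operatorname{Gir}(\Gamma)=\sup_S\operatorname{Gir}(\Gamma,S)$ over all finite generating sets $S$. Let $\Gamma$ act by homeomorphisms on a compact Hausdorff space $M$. The action is minimal if every orbit is dense. It is extremely proximal if for every two nonempty open subsets $U,V\subseteq M$ there is $g\in\Gamma$ with $g(M\setminus U)\subseteq V$. It is an extreme boundary action if it is minimal and extremely proximal. It is topologically free if $\operatorname{Fix}(g)=\{x\in M: gx=x\}$ has empty interior for every $g\in\Gamma\setminus\{e\}$. *)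

theory Defs
  imports
    "HOL-Analysis.Analysis"
    "HOL-Library.Extended_Nat"
    "HOL-Algebra.Group_Action"
    "HOL-Algebra.Generated_Groups"
begin

section \<open>Words in a formal alphabet\<close>

text \<open>
  The letter \<open>(s, True)\<close> stands for the generator \<open>s\<close> and \<open>(s, False)\<close> for its formal inverse.
  The alphabet is formal: if \<open>s\<close> and its group inverse \<open>t\<close> both lie in \<open>S\<close>, then \<open>(s, False)\<close>
  and \<open>(t, True)\<close> are different letters. Likewise \<open>(s, True)\<close> and \<open>(s, False)\<close> are
  different letters even if \<open>s\<close> is an involution or the identity.
\<close>

type_synonym 'a letter = "'a \<times> bool"

definition words :: "'a set \<Rightarrow> 'a letter list set" where
  "words S = lists (S \<times> UNIV)"

fun formal_inv :: "'a letter \<Rightarrow> 'a letter" where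
  "formal_inv (s, b) = (s, \<not> b)"

definition reduced :: "'a letter list \<Rightarrow> bool" where
  "reduced w \<longleftrightarrow> successively (\<lambda>x y. y \<noteq> formal_inv x) w"

definition cyclically_reduced :: "'a letter list \<Rightarrow> bool" where
  "cyclically_reduced w \<longleftrightarrow> reduced w \<and> (w \<noteq> [] \<longrightarrow> hd w \<noteq> formal_inv (last w))"

fun letter_val :: "('a, 'c) monoid_scheme \<Rightarrow> 'a letter \<Rightarrow> 'a" where
  "letter_val G (s, b) = (if b then s else inv\<^bsub>G\<^esub> s)"

definition word_val :: "('a, 'c) monoid_scheme \<Rightarrow> 'a letter list \<Rightarrow> 'a" where
  "word_val G w = foldr (\<lambda>x g. letter_val G x \<otimes>\<^bsub>G\<^esub> g) w \<one>\<^bsub>G\<^esub>"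


section \<open>Girth\<close>

definition finite_generating_set :: "('a, 'c) monoid_scheme \<Rightarrow> 'a set \<Rightarrow> bool" where
  "finite_generating_set G S \<longleftrightarrow> finite S \<and> S \<subseteq> carrier G \<and> generate G S = carrier G"

definition finitely_generated :: "('a, 'c) monoid_scheme \<Rightarrow> bool" where
  "finitely_generated G \<longleftrightarrow> (\<exists>S. finite_generating_set G S)"

text \<open>The infimum of the empty set in \<^typ>\<open>enat\<close> is \<open>\<infinity>\<close>; a nonempty infimum is a minimum.\<close>

definition girth_wrt :: "('a, 'c) monoid_scheme \<Rightarrow> 'a set \<Rightarrow> enat" where
  "girth_wrt G S =
     Inf {enat (length w) | w.
            w \<in> words S \<and> w \<noteq> [] \<and> cyclically_reduced w \<and> word_val G w = \<one>\<^bsub>G\<^esub>}"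

definition girth :: "('a, 'c) monoid_scheme \<Rightarrow> enat" where
  "girth G = Sup {girth_wrt G S | S. finite_generating_set G S}"


section \<open>Actions by homeomorphisms\<close>

definition action_by_homeomorphisms ::
    "('a, 'c) monoid_scheme \<Rightarrow> 'b topology \<Rightarrow> ('a \<Rightarrow> 'b \<Rightarrow> 'b) \<Rightarrow> bool" where
  "action_by_homeomorphisms G X \<phi> \<longleftrightarrow>
     group_action G (topspace X) \<phi> \<and> (\<forall>g \<in> carrier G. homeomorphic_map X X (\<phi> g))"

definition minimal_action ::
    "('a, 'c) monoid_scheme \<Rightarrow> 'b topology \<Rightarrow> ('a \<Rightarrow> 'b \<Rightarrow> 'b) \<Rightarrow> bool" where
  "minimal_action G X \<phi> \<longleftrightarrow>
     (\<forall>x \<in> topspace X. X closure_of (orbit G \<phi> x) = topspace X)"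

definition extremely_proximal ::
    "('a, 'c) monoid_scheme \<Rightarrow> 'b topology \<Rightarrow> ('a \<Rightarrow> 'b \<Rightarrow> 'b) \<Rightarrow> bool" where
  "extremely_proximal G X \<phi> \<longleftrightarrow>
     (\<forall>U V. openin X U \<and> U \<noteq> {} \<and> openin X V \<and> V \<noteq> {} \<longrightarrow>
        (\<exists>g \<in> carrier G. \<phi> g ` (topspace X - U) \<subseteq> V))"

definition extreme_boundary_action ::
    "('a, 'c) monoid_scheme \<Rightarrow> 'b topology \<Rightarrow> ('a \<Rightarrow> 'b \<Rightarrow> 'b) \<Rightarrow> bool" where
  "extreme_boundary_action G X \<phi> \<longleftrightarrow>
     action_by_homeomorphisms G X \<phi> \<and> minimal_action G X \<phi> \<and> extremely_proximal G X \<phi>"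

text \<open>\<open>invariants (topspace X) \<phi> g\<close> is the set of points of \<open>X\<close> fixed by \<open>g\<close>.\<close>

definition topologically_free ::
    "('a, 'c) monoid_scheme \<Rightarrow> 'b topology \<Rightarrow> ('a \<Rightarrow> 'b \<Rightarrow> 'b) \<Rightarrow> bool" where
  "topologically_free G X \<phi> \<longleftrightarrow>
     (\<forall>g \<in> carrier G - {\<one>\<^bsub>G\<^esub>}. X interior_of (invariants (topspace X) \<phi> g) = {})"

end

theory Submission
  imports Defs
begin

text \<open>
  Fix a bound \<open>n\<close> and a finite generating set \<open>S\<close>. The plan is to replace \<open>S\<close> by
  \<open>{g} \<union> {g ^ N s \<cdot> s \<cdot> g ^ N s | s \<in> S, s \<noteq> 1}\<close> for a suitable group element \<open>g\<close> and suitable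
  integers \<open>N s\<close>. This set generates whatever \<open>g\<close> and the exponents are. If the numbers \<open>N s\<close>
  exceed \<open>n\<close> and lie more than \<open>n\<close> apart from each other, then a nonempty reduced word of length
  at most \<open>n\<close> in the new generators becomes, after collecting powers of \<open>g\<close>, an alternating product
  \<open>g ^ a\<^sub>0 \<cdot> c\<^sub>1 \<cdot> g ^ a\<^sub>1 \<cdots> c\<^sub>k \<cdot> g ^ a\<^sub>k\<close> in which every \<open>a\<^sub>i\<close> is nonzero and every
  \<open>c\<^sub>i\<close> is a nontrivial element of \<open>S\<close> or the inverse of one: the at most \<open>n\<close> letters \<open>g\<close> or
  inverses of \<open>g\<close> cannot compensate the exponents of the other letters, and where these exponents
  cancel each other, between a new generator and its own inverse, reducedness leaves a nonzero
  power of \<open>g\<close>.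

  The dynamics serve to choose \<open>g\<close> so that no such product is trivial. By topological freeness there
  is a nonempty open set \<open>U\<close>, not the whole space, which every nontrivial element of \<open>S\<close> moves off
  itself (\<open>displaced_open_set\<close>). The space has no isolated points, so \<open>U\<close> contains disjoint nonempty
  open sets \<open>A\<close> and \<open>B\<close>, and extreme proximality provides \<open>g\<close> mapping the complement of \<open>A\<close> into
  \<open>B\<close>; then all nonzero powers of \<open>g\<close> map the complement of \<open>U\<close> into \<open>U\<close>
  (\<open>absorbing_element\<close>). Now play ping-pong with a point outside \<open>U\<close>: a nonzero power of \<open>g\<close>
  throws it into \<open>U\<close>, an element \<open>c\<^sub>i\<close> throws it out again, and as both ends of the product are
  nonzero powers of \<open>g\<close>, the point finally lands in \<open>U\<close>. Hence the product moves it
  (\<open>reduced_word_nontrivial\<close>).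
\<close>

section \<open>Ping-pong with widely separated exponents\<close>

text \<open>
  The elements of \<open>Y\<close> are the new generators other than \<open>g\<close>; \<open>\<sigma>\<close> and \<open>N\<close> record how each of them
  was made. Indexing by \<open>Y\<close> instead of by the old generators makes the letters of a word
  decodable even if two old generators were to give the same new one.
\<close>

locale ping_pong = group_action G E \<phi> + group G
  for G (structure) and E :: "'b set" and \<phi> :: "'a \<Rightarrow> 'b \<Rightarrow> 'b" +
  fixes g :: 'a and U :: "'b set" and Y :: "'a set" and \<sigma> :: "'a \<Rightarrow> 'a"
    and N :: "'a \<Rightarrow> int" and n :: nat
  assumes g_closed: "g \<in> carrier G"
    and g_notin: "g \<notin> Y"
    and U_subset: "U \<subseteq> E"
    and power_absorbs: "\<And>a x. a \<noteq> 0 \<Longrightarrow> x \<in> E - U \<Longrightarrow> \<phi> (g [^] (a::int)) x \<in> U"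
    and core_closed: "\<And>y. y \<in> Y \<Longrightarrow> \<sigma> y \<in> carrier G"
    and core_displaces: "\<And>y u. y \<in> Y \<Longrightarrow> u \<in> U \<Longrightarrow> \<phi> (\<sigma> y) u \<notin> U"
    and twisted: "\<And>y. y \<in> Y \<Longrightarrow> y = g [^] N y \<otimes> \<sigma> y \<otimes> g [^] N y"
    and exponent_large: "\<And>y. y \<in> Y \<Longrightarrow> int n < N y"
    and exponents_apart: "\<And>y y'. y \<in> Y \<Longrightarrow> y' \<in> Y \<Longrightarrow> y \<noteq> y' \<Longrightarrow> int n < \<bar>N y - N y'\<bar>"
begin

fun core :: "'a letter \<Rightarrow> 'a" where
  "core (y, b) = (if b then \<sigma> y else inv (\<sigma> y))"

fun exponent :: "'a letter \<Rightarrow> int" where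
  "exponent (y, b) = (if b then N y else - N y)"

lemma core_letter_closed: "l \<in> Y \<times> UNIV \<Longrightarrow> core l \<in> carrier G"
  by (cases l) (auto simp: core_closed)

lemma letter_val_twisted:
  assumes "l \<in> Y \<times> UNIV"
  shows "letter_val G l = g [^] exponent l \<otimes> core l \<otimes> g [^] exponent l"
proof -
  obtain y b where l: "l = (y, b)" and y: "y \<in> Y" using assms by auto
  have "inv y = inv (g [^] N y \<otimes> \<sigma> y \<otimes> g [^] N y)"
    using twisted[OF y] by simp
  also have "\<dots> = g [^] (- N y) \<otimes> inv (\<sigma> y) \<otimes> g [^] (- N y)"
    using g_closed core_closed[OF y] by (simp add: inv_mult_group int_pow_neg m_assoc)
  finally show ?thesis using l twisted[OF y] by (cases b) simp_all
qed

lemma core_leaves: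
  assumes "l \<in> Y \<times> UNIV" "u \<in> U"
  shows "\<phi> (core l) u \<in> E - U"
proof -
  obtain y b where l: "l = (y, b)" and y: "y \<in> Y" using assms by auto
  have u: "u \<in> E" using assms U_subset by auto
  have c: "\<sigma> y \<in> carrier G" using core_closed[OF y] .
  have "\<phi> (inv (\<sigma> y)) u \<notin> U"
  proof
    assume "\<phi> (inv (\<sigma> y)) u \<in> U"
    then have "\<phi> (\<sigma> y) (\<phi> (inv (\<sigma> y)) u) \<notin> U" using core_displaces[OF y] by blast
    moreover have "\<phi> (\<sigma> y) (\<phi> (inv (\<sigma> y)) u) = u"
      using composition_rule[OF u c inv_closed[OF c]] c id_eq_one u by (simp add: fun_eq_iff)
        (metis restrict_apply')
    ultimately show False using assms by simp
  qed
  then show ?thesis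
    using l core_displaces[OF y assms(2)] element_image[OF c u refl]
      element_image[OF inv_closed[OF c] u refl] by auto
qed

text \<open>
  The arithmetic heart: between two twisted letters of a reduced word, the collected exponent of
  \<open>g\<close> does not vanish. When the two letters come from different generators or have the same
  sign, the two exponents add up to something too large for \<open>a\<close> to cancel. In the remaining case they
  cancel each other and only \<open>a\<close> is left, which is zero only if the letters are adjacent
  and thus inverse to each other.
\<close>

lemma exponents_do_not_cancel:
  assumes "l \<in> Y \<times> UNIV" "l' \<in> Y \<times> UNIV" "\<bar>a\<bar> \<le> int n"
    and "a = 0 \<Longrightarrow> l' \<noteq> formal_inv l"
  shows "exponent l + a + exponent l' \<noteq> 0"
proof -
  obtain y b y' b' where l: "l = (y, b)" "l' = (y', b')" and y: "y \<in> Y" "y' \<in> Y"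
    using assms by auto
  note large = exponent_large[OF y(1)] exponent_large[OF y(2)]
  show ?thesis
  proof (cases "b = b'")
    case True
    then show ?thesis using large l assms(3) by auto
  next
    case False
    show ?thesis
    proof (cases "y = y'")
      case True
      then show ?thesis using False l assms(4) by auto
    next
      case neq: False
      show ?thesis using exponents_apart[OF y neq] False l assms(3) by auto
    qed
  qed
qed

lemma exponent_dominates:
  assumes "l \<in> Y \<times> UNIV" "\<bar>a\<bar> \<le> int n"
  shows "exponent l + a \<noteq> 0"
proof -
  obtain y b where "l = (y, b)" "y \<in> Y" using assms(1) by auto
  then show ?thesis using exponent_large[of y] assms(2) by auto
qed

lemma letter_val_closed: "l \<in> insert g Y \<times> UNIV \<Longrightarrow> letter_val G l \<in> carrier G"
proof -
  assume l: "l \<in> insert g Y \<times> UNIV"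
  have "y \<in> carrier G" if "y \<in> Y" for y
    by (subst twisted[OF that]) (simp add: g_closed core_closed[OF that])
  then show ?thesis using l g_closed by (cases l) auto
qed

lemma word_val_closed: "w \<in> words (insert g Y) \<Longrightarrow> word_val G w \<in> carrier G"
  by (induction w) (auto simp: word_val_def words_def simp del: letter_val.simps intro!: letter_val_closed)

text \<open>
  The invariant of the ping-pong game, read from the right end of the word: \<open>a\<close> is the contribution
  of the letters \<open>g\<close> and inverses of \<open>g\<close> in front of the first twisted letter \<open>l\<close>, and \<open>e\<close> is the
  exponent contributed by \<open>l\<close> itself, or zero if there is none. The first letter of the word has
  to be remembered because it governs which letters may be put in front without violating reducedness.
\<close>

lemma reduced_word_position:
  assumes "z \<in> E - U" "w \<in> words (insert g Y)" "reduced w" "length w \<le> n"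
  shows "\<exists>a e v. \<bar>a\<bar> \<le> int (length w) \<and> v \<in> E - U \<and>
           \<phi> (word_val G w) z = \<phi> (g [^] (a + e)) v \<and>
           (a \<noteq> 0 \<longrightarrow> w \<noteq> [] \<and> hd w = (g, 0 < a)) \<and>
           (e = 0 \<and> (a = 0 \<longrightarrow> w = []) \<or>
            (\<exists>l \<in> Y \<times> UNIV. e = exponent l \<and> (a = 0 \<longrightarrow> w \<noteq> [] \<and> hd w = l)))"
  using assms(2-4)
proof (induction w)
  case Nil
  show ?case
    by (rule exI[of _ 0], rule exI[of _ 0], rule exI[of _ z])
      (use assms(1) in \<open>simp add: word_val_def\<close>)
next
  case (Cons x w)
  have x: "x \<in> insert g Y \<times> UNIV" and w: "w \<in> words (insert g Y)"
    using Cons.prems(1) by (auto simp: words_def)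
  have red: "reduced w" and hd: "w \<noteq> [] \<Longrightarrow> hd w \<noteq> formal_inv x"
    using Cons.prems(2) by (auto simp: reduced_def successively_Cons)
  have len: "length w \<le> n" using Cons.prems(3) by simp
  obtain a e v where IH: "\<bar>a\<bar> \<le> int (length w)" "v \<in> E - U"
      "\<phi> (word_val G w) z = \<phi> (g [^] (a + e)) v"
      "a \<noteq> 0 \<longrightarrow> w \<noteq> [] \<and> hd w = (g, 0 < a)"
      "e = 0 \<and> (a = 0 \<longrightarrow> w = []) \<or>
       (\<exists>l \<in> Y \<times> UNIV. e = exponent l \<and> (a = 0 \<longrightarrow> w \<noteq> [] \<and> hd w = l))"
    using Cons.IH[OF w red len] by (elim exE conjE)
  have z: "z \<in> E" and v: "v \<in> E" using assms IH by auto
  have pow: "g [^] k \<in> carrier G" for k :: int using g_closed by simp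
  have step: "\<phi> (word_val G (x # w)) z = \<phi> (letter_val G x) (\<phi> (g [^] (a + e)) v)"
    using composition_rule[OF z letter_val_closed[OF x] word_val_closed[OF w]] IH(3)
    by (simp add: word_val_def)
  show ?case
  proof (cases "fst x = g")
    case True
    then obtain b where xb: "x = (g, b)" by (cases x) auto
    define d :: int where "d = (if b then 1 else - 1)"
    have "letter_val G x = g [^] d"
      using xb g_closed by (simp add: d_def int_pow_neg)
    then have position: "\<phi> (word_val G (x # w)) z = \<phi> (g [^] ((d + a) + e)) v"
      using step composition_rule[OF v pow pow] by (simp add: int_pow_mult[OF g_closed, symmetric] add.assoc)
    have bound: "\<bar>d + a\<bar> \<le> int (length (x # w))" using IH(1) by (auto simp: d_def)
    have sgn: "d + a \<noteq> 0" "(0 < d + a) = b"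
      using IH(4) hd xb by (cases "a = 0"; auto simp: d_def split: if_splits)+
    have "x # w \<noteq> [] \<and> hd (x # w) = (g, 0 < d + a)" using xb sgn(2) by simp
    moreover have "e = 0 \<and> (d + a = 0 \<longrightarrow> x # w = []) \<or>
        (\<exists>l \<in> Y \<times> UNIV. e = exponent l \<and> (d + a = 0 \<longrightarrow> x # w \<noteq> [] \<and> hd (x # w) = l))"
      using IH(5) sgn(1) by meson
    ultimately show ?thesis using bound position IH(2) by blast
  next
    case False
    then have xY: "x \<in> Y \<times> UNIV" using x by auto
    let ?m = "exponent x + a + e"
    have a: "\<bar>a\<bar> \<le> int n" using IH(1) Cons.prems(3) by simp
    have "?m \<noteq> 0"
      using IH(5)
    proof (elim disjE bexE conjE)
      assume "e = 0"
      then show ?thesis using exponent_dominates[OF xY a] by simp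
    next
      fix l assume l: "l \<in> Y \<times> UNIV" "e = exponent l" "a = 0 \<longrightarrow> w \<noteq> [] \<and> hd w = l"
      then show ?thesis using exponents_do_not_cancel[OF xY l(1) a] hd by auto
    qed
    then have "\<phi> (g [^] ?m) v \<in> U" using power_absorbs IH(2) by blast
    then have out: "\<phi> (core x) (\<phi> (g [^] ?m) v) \<in> E - U" using core_leaves[OF xY] by blast
    have im: "\<phi> (g [^] k) v \<in> E" for k :: int using element_image[OF pow v refl] .
    have "\<phi> (word_val G (x # w)) z =
        \<phi> (g [^] exponent x) (\<phi> (core x) (\<phi> (g [^] exponent x) (\<phi> (g [^] (a + e)) v)))"
      using step letter_val_twisted[OF xY] im core_letter_closed[OF xY] pow
        element_image[OF pow im refl]
      by (simp add: composition_rule del: letter_val.simps)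
    also have "\<phi> (g [^] exponent x) (\<phi> (g [^] (a + e)) v) = \<phi> (g [^] ?m) v"
      using composition_rule[OF v pow pow] by (simp add: int_pow_mult[OF g_closed, symmetric] add.assoc)
    finally have "\<phi> (word_val G (x # w)) z =
        \<phi> (g [^] (0 + exponent x)) (\<phi> (core x) (\<phi> (g [^] ?m) v))"
      by simp
    moreover have "exponent x = 0 \<and> (0 = (0::int) \<longrightarrow> x # w = []) \<or>
        (\<exists>l \<in> Y \<times> UNIV. exponent x = exponent l \<and> ((0::int) = 0 \<longrightarrow> x # w \<noteq> [] \<and> hd (x # w) = l))"
      using xY by (intro disjI2 bexI[of _ x]) simp_all
    moreover have "\<bar>0\<bar> \<le> int (length (x # w))" by simp
    ultimately show ?thesis using out by blast
  qed
qed

lemma reduced_word_nontrivial: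
  assumes "z \<in> E - U" "w \<in> words (insert g Y)" "reduced w" "length w \<le> n" "w \<noteq> []"
  shows "word_val G w \<noteq> \<one>"
proof
  assume triv: "word_val G w = \<one>"
  obtain a e v where pos: "\<bar>a\<bar> \<le> int (length w)" "v \<in> E - U"
      "\<phi> (word_val G w) z = \<phi> (g [^] (a + e)) v"
      "e = 0 \<and> (a = 0 \<longrightarrow> w = []) \<or> (\<exists>l \<in> Y \<times> UNIV. e = exponent l)"
    using reduced_word_position[OF assms(1-4)] by blast
  have "\<bar>a\<bar> \<le> int n" using pos(1) assms(4) by simp
  then have "a + e \<noteq> 0"
    using pos(4) assms(5) exponent_dominates by (auto simp: add.commute)
  then have "\<phi> (word_val G w) z \<in> U" using power_absorbs pos(2,3) by simp
  moreover have "\<phi> \<one> z = z" using id_eq_one assms(1) by (metis DiffD1 restrict_apply')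
  ultimately show False using triv assms(1) by simp
qed

end


section \<open>Dynamics of topologically free, extremely proximal actions\<close>

text \<open>
  The elements are treated one after the other: an open set on which \<open>c\<close> is not the
  identity contains a point moved by \<open>c\<close>, and the Hausdorff property separates a small
  neighbourhood of it from its image.
\<close>

lemma displaced_open_set:
  assumes act: "action_by_homeomorphisms G X \<phi>" and free: "topologically_free G X \<phi>"
    and haus: "Hausdorff_space X"
    and "finite F" "F \<subseteq> carrier G - {\<one>\<^bsub>G\<^esub>}" "openin X W" "W \<noteq> {}"
  shows "\<exists>U. openin X U \<and> U \<noteq> {} \<and> U \<subseteq> W \<and> (\<forall>c \<in> F. \<forall>u \<in> U. \<phi> c u \<notin> U)"
  using assms(4,5)
proof (induction F)
  case empty
  then show ?case using assms(6,7) by blast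
next
  case (insert c F)
  then obtain U where U: "openin X U" "U \<noteq> {}" "U \<subseteq> W" "\<forall>c \<in> F. \<forall>u \<in> U. \<phi> c u \<notin> U"
    by blast
  have c: "c \<in> carrier G - {\<one>\<^bsub>G\<^esub>}" using insert.prems by simp
  have cont: "continuous_map X X (\<phi> c)"
    using act c by (auto simp: action_by_homeomorphisms_def homeomorphic_imp_continuous_map)
  have "\<not> U \<subseteq> invariants (topspace X) \<phi> c"
  proof
    assume "U \<subseteq> invariants (topspace X) \<phi> c"
    then have "U \<subseteq> X interior_of (invariants (topspace X) \<phi> c)"
      using U(1) by (rule interior_of_maximal)
    also have "\<dots> = {}" using free c unfolding topologically_free_def by (rule bspec)
    finally show False using U(2) by simp
  qed
  then obtain x where x: "x \<in> U" "x \<in> topspace X" "\<phi> c x \<noteq> x"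
    using openin_subset[OF U(1)] by (auto simp: invariants_def)
  have image: "\<phi> c x \<in> topspace X" using continuous_map_image_subset_topspace[OF cont] x(2) by blast
  obtain A B where AB: "openin X A" "openin X B" "x \<in> A" "\<phi> c x \<in> B" "disjnt A B"
    using haus[unfolded Hausdorff_space_def, rule_format, OF conjI[OF x(2) conjI[OF image not_sym[OF x(3)]]]]
    by (elim exE conjE)
  let ?V = "U \<inter> A \<inter> {x \<in> topspace X. \<phi> c x \<in> B}"
  have V: "openin X ?V"
    by (intro openin_Int U(1) AB(1) openin_continuous_map_preimage[OF cont AB(2)])
  have nonempty: "?V \<noteq> {}" using x AB by auto
  have subset: "?V \<subseteq> W" using U(3) by auto
  have displaced: "\<phi> c' u \<notin> ?V" if "c' \<in> insert c F" "u \<in> ?V" for c' u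
  proof (cases "c' = c")
    case True
    then show ?thesis using that(2) AB(5) unfolding disjnt_iff by blast
  next
    case False
    then show ?thesis using that U(4) by blast
  qed
  show ?case
  proof (rule exI[of _ ?V], intro conjI ballI)
    show "\<phi> c' u \<notin> ?V" if "c' \<in> insert c F" "u \<in> ?V" for c' u
      using that by (rule displaced)
  qed (rule V nonempty subset)+
qed

text \<open>
  If \<open>{p}\<close> were open, extreme proximality would compress the complement of \<open>{p}\<close> injectively
  into \<open>{p}\<close>, so there would be at most two points.
\<close>

lemma no_isolated_point:
  assumes act: "action_by_homeomorphisms G X \<phi>" and prox: "extremely_proximal G X \<phi>"
    and three: "x \<in> topspace X" "y \<in> topspace X" "z \<in> topspace X" "x \<noteq> y" "y \<noteq> z" "x \<noteq> z"
  shows "\<not> openin X {p}"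
proof
  assume "openin X {p}"
  then obtain g where g: "g \<in> carrier G" "\<phi> g ` (topspace X - {p}) \<subseteq> {p}"
    using prox unfolding extremely_proximal_def by (meson insert_not_empty)
  interpret group_action G "topspace X" \<phi>
    using act by (simp add: action_by_homeomorphisms_def)
  have collapse: "u = v" if "u \<in> topspace X - {p}" "v \<in> topspace X - {p}" for u v
  proof -
    have "\<phi> g u = p" "\<phi> g v = p" using that g(2) by auto
    then show ?thesis using inj_onD[OF inj_prop[OF g(1)], of u v] that by simp
  qed
  show False using collapse[of x y] collapse[of y z] collapse[of x z] three by auto
qed

text \<open>
  Once \<open>g\<close> maps the complement of \<open>A\<close> into \<open>B\<close>, it maps \<open>B\<close> into itself because \<open>B\<close> misses \<open>A\<close>; so
  its positive powers map the complement of \<open>A\<close> into \<open>B\<close>, and symmetrically its negative powers map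
  the complement of \<open>B\<close> into \<open>A\<close>.
\<close>

lemma (in group_action) powers_absorb:
  assumes g: "g \<in> carrier G" and sub: "A \<subseteq> E" "B \<subseteq> E" and disj: "A \<inter> B = {}"
    and maps: "\<phi> g ` (E - A) \<subseteq> B"
    and a: "a \<noteq> (0::int)" and x: "x \<in> E - (A \<union> B)"
  shows "\<phi> (g [^] a) x \<in> A \<union> B"
proof -
  interpret group G using group_hom by (simp add: group_hom_def)
  have id: "\<phi> \<one> u = u" if "u \<in> E" for u using id_eq_one that by (metis restrict_apply')
  have maps_inv: "\<phi> (inv g) u \<in> A" if u: "u \<in> E - B" for u
  proof (rule ccontr)
    assume "\<phi> (inv g) u \<notin> A"
    moreover have "\<phi> (inv g) u \<in> E" using u element_image[OF inv_closed[OF g]] by blast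
    ultimately have "\<phi> g (\<phi> (inv g) u) \<in> B" using maps by blast
    moreover have "\<phi> g (\<phi> (inv g) u) = u"
      using composition_rule[of u g "inv g"] u g id by simp
    ultimately show False using u by simp
  qed
  have pos: "\<phi> (g [^] Suc k) x \<in> B" for k
  proof (induction k)
    case 0
    show ?case using maps x g by auto
  next
    case (Suc k)
    have "g [^] Suc (Suc k) = g \<otimes> g [^] Suc k" using g nat_pow_Suc2 by blast
    then have "\<phi> (g [^] Suc (Suc k)) x = \<phi> g (\<phi> (g [^] Suc k) x)"
      using composition_rule[of x g "g [^] Suc k"] g x by simp
    moreover have "\<phi> (g [^] Suc k) x \<in> E - A" using Suc disj sub by blast
    ultimately show ?case using maps by auto
  qed
  have neg: "\<phi> (inv g [^] Suc k) x \<in> A" for k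
  proof (induction k)
    case 0
    show ?case using maps_inv x g by auto
  next
    case (Suc k)
    have "inv g [^] Suc (Suc k) = inv g \<otimes> inv g [^] Suc k" using g nat_pow_Suc2 by blast
    then have "\<phi> (inv g [^] Suc (Suc k)) x = \<phi> (inv g) (\<phi> (inv g [^] Suc k) x)"
      using composition_rule[of x "inv g" "inv g [^] Suc k"] g x by simp
    moreover have "\<phi> (inv g [^] Suc k) x \<in> E - B" using Suc disj sub by blast
    ultimately show ?case using maps_inv by simp
  qed
  show ?thesis
  proof (cases "0 < a")
    case True
    then obtain k where "a = int (Suc k)" using zero_less_imp_eq_int gr0_implies_Suc by metis
    then show ?thesis using pos[of k] by (simp only: int_pow_int) blast
  next
    case False
    then have "0 < - a" using a by simp
    then obtain k where "- a = int (Suc k)" using zero_less_imp_eq_int gr0_implies_Suc by metis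
    then have "a = - int (Suc k)" by simp
    then have "g [^] a = inv g [^] Suc k"
      using g by (simp only: int_pow_neg_int nat_pow_inv)
    then show ?thesis using neg[of k] by simp
  qed
qed

text \<open>
  As \<open>U\<close> is not a single point, it contains disjoint nonempty open sets \<open>A\<close> and \<open>B\<close>, and extreme
  proximality yields a \<open>g\<close> that sends the complement of \<open>A\<close> into \<open>B\<close>.
\<close>

lemma absorbing_element:
  assumes act: "action_by_homeomorphisms G X \<phi>" and prox: "extremely_proximal G X \<phi>"
    and haus: "Hausdorff_space X"
    and isol: "\<And>p. \<not> openin X {p}" and U: "openin X U" "U \<noteq> {}"
  obtains g where "g \<in> carrier G"
    and "\<And>a x. a \<noteq> (0::int) \<Longrightarrow> x \<in> topspace X - U \<Longrightarrow> \<phi> (g [^]\<^bsub>G\<^esub> a) x \<in> U"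
proof -
  interpret group_action G "topspace X" \<phi>
    using act by (simp add: action_by_homeomorphisms_def)
  obtain p where p: "p \<in> U" using U by blast
  obtain q where q: "q \<in> U" "q \<noteq> p" using isol[of p] U p by (metis insertI1 is_singletonI' is_singleton_def singletonD)
  obtain A B where AB: "openin X A" "openin X B" "p \<in> A" "q \<in> B" "disjnt A B"
    using haus p q openin_subset[OF U(1)] unfolding Hausdorff_space_def by (metis subsetD)
  have "openin X (U \<inter> A)" "openin X (U \<inter> B)" "U \<inter> A \<noteq> {}" "U \<inter> B \<noteq> {}"
    using U AB p q by auto
  then obtain g where g: "g \<in> carrier G" "\<phi> g ` (topspace X - U \<inter> A) \<subseteq> U \<inter> B"
    using prox unfolding extremely_proximal_def by meson
  have "\<phi> (g [^]\<^bsub>G\<^esub> a) x \<in> U" if "a \<noteq> 0" "x \<in> topspace X - U" for a :: int and x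
    using powers_absorb[OF g(1) _ _ _ g(2) that(1), of x] that(2) AB(5) openin_subset[OF U(1)]
    by (auto simp: disjnt_def)
  then show thesis using that g(1) by blast
qed


section \<open>Generating sets without short relations\<close>

lemma (in group) generates_twisted:
  fixes N :: "'a \<Rightarrow> int"
  assumes S: "finite_generating_set G S" and g: "g \<in> carrier G"
  shows "finite_generating_set G (insert g ((\<lambda>s. g [^] N s \<otimes> s \<otimes> g [^] N s) ` (S - {\<one>})))"
    (is "finite_generating_set G ?T")
proof -
  have S': "finite S" "S \<subseteq> carrier G" "generate G S = carrier G"
    using S by (auto simp: finite_generating_set_def)
  have T: "?T \<subseteq> carrier G" using S' g by auto
  note sub = generate_is_subgroup[OF T]
  have pow: "g [^] k \<in> generate G ?T" for k :: int
    by (rule subgroup_int_pow_closed[OF sub]) (simp add: generate.incl)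
  have "s \<in> generate G ?T" if "s \<in> S" for s
  proof (cases "s = \<one>")
    case False
    let ?y = "g [^] N s \<otimes> s \<otimes> g [^] N s"
    have s: "s \<in> carrier G" using that S' by auto
    have y: "?y \<in> generate G ?T" using that False by (intro generate.incl) auto
    have conj: "g [^] (- N s) \<otimes> ?y \<otimes> g [^] (- N s) \<in> generate G ?T"
      by (rule subgroup.m_closed[OF sub subgroup.m_closed[OF sub pow y] pow])
    have left: "g [^] (- N s) \<otimes> ?y = s \<otimes> g [^] N s"
      using g s by (simp add: int_pow_neg m_assoc[symmetric])
    have right: "s \<otimes> g [^] N s \<otimes> g [^] (- N s) = s"
      using m_assoc[of s "g [^] N s" "g [^] (- N s)"] g s by (simp add: int_pow_neg)
    show ?thesis using conj unfolding left right .
  qed (simp add: generate.one)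
  then have "generate G S \<subseteq> generate G ?T"
    by (intro generate_subgroup_incl[OF _ sub] subsetI)
  then have "generate G ?T = carrier G" using S'(3) generate_incl[OF T] by simp
  then show ?thesis using S'(1) T by (simp add: finite_generating_set_def)
qed

lemma girth_infiniteI:
  assumes "\<And>n. \<exists>S. finite_generating_set G S \<and>
      (\<forall>w \<in> words S. w \<noteq> [] \<longrightarrow> reduced w \<longrightarrow> length w \<le> n \<longrightarrow> word_val G w \<noteq> \<one>\<^bsub>G\<^esub>)"
  shows "girth G = \<infinity>"
proof -
  have "enat n \<le> girth G" for n
  proof -
    obtain S where S: "finite_generating_set G S"
      "\<forall>w \<in> words S. w \<noteq> [] \<longrightarrow> reduced w \<longrightarrow> length w \<le> n \<longrightarrow> word_val G w \<noteq> \<one>\<^bsub>G\<^esub>"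
      using assms by blast
    have "enat n \<le> girth_wrt G S"
      unfolding girth_wrt_def using S(2)
      by (intro Inf_greatest) (fastforce simp: cyclically_reduced_def)
    also have "\<dots> \<le> girth G"
      unfolding girth_def using S(1) by (intro Sup_upper) auto
    finally show ?thesis .
  qed
  then show ?thesis
    by (metis enat_ord_simps(1) not_enat_eq not_less_eq_eq order_refl)
qed

theorem theorem1:
  fixes G :: "('a, 'c) monoid_scheme"
    and X :: "'b topology"
    and \<phi> :: "'a \<Rightarrow> 'b \<Rightarrow> 'b"
  assumes "group G"
    and "finitely_generated G"
    and "compact_space X"
    and "Hausdorff_space X"
    and "\<exists>x y z. x \<in> topspace X \<and> y \<in> topspace X \<and> z \<in> topspace X \<and> x \<noteq> y \<and> y \<noteq> z \<and> x \<noteq> z"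
    and "extreme_boundary_action G X \<phi>"
    and "topologically_free G X \<phi>"
  shows "girth G = \<infinity>"
proof (rule girth_infiniteI)
  fix n :: nat
  interpret group G by fact
  have act: "action_by_homeomorphisms G X \<phi>" and prox: "extremely_proximal G X \<phi>"
    using assms(6) by (auto simp: extreme_boundary_action_def)
  obtain S where S: "finite_generating_set G S" using assms(2) by (auto simp: finitely_generated_def)
  then have finS: "finite S" and subS: "S \<subseteq> carrier G" by (auto simp: finite_generating_set_def)
  obtain x y z where xyz: "x \<in> topspace X" "y \<in> topspace X" "z \<in> topspace X"
      "x \<noteq> y" "y \<noteq> z" "x \<noteq> z"
    using assms(5) by blast
  obtain W where W: "openin X W" "x \<in> W" "z \<notin> W"
    using assms(4) xyz unfolding Hausdorff_space_def disjnt_iff by metis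
  obtain U where U: "openin X U" "U \<noteq> {}" "U \<subseteq> W" "\<forall>c \<in> S - {\<one>\<^bsub>G\<^esub>}. \<forall>u \<in> U. \<phi> c u \<notin> U"
    using displaced_open_set[OF act assms(7,4), of "S - {\<one>\<^bsub>G\<^esub>}" W] finS subS W by blast
  obtain g where g: "g \<in> carrier G"
    and absorbs: "\<And>a x. a \<noteq> (0::int) \<Longrightarrow> x \<in> topspace X - U \<Longrightarrow> \<phi> (g [^]\<^bsub>G\<^esub> a) x \<in> U"
    using absorbing_element[OF act prox assms(4) no_isolated_point[OF act prox xyz] U(1,2)] by blast
  obtain index :: "'a \<Rightarrow> nat" where index: "inj_on index S"
    using finite_imp_inj_to_nat_seg[OF finS] by blast
  \<comment> \<open>Distinct positive multiples of \<open>n + 1\<close> are larger than \<open>n\<close> and more than \<open>n\<close> apart.\<close>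
  define N where "N s = int (Suc n) * (int (index s) + 1)" for s
  have large: "int n < N s" for s
  proof -
    have "int (Suc n) * 1 \<le> N s" unfolding N_def by (intro mult_left_mono) auto
    then show ?thesis by simp
  qed
  have apart: "int n < \<bar>N s - N t\<bar>" if "s \<in> S" "t \<in> S" "s \<noteq> t" for s t
  proof -
    have "index s \<noteq> index t" using inj_onD[OF index] that by blast
    then have "1 \<le> \<bar>int (index s) - int (index t)\<bar>" by linarith
    then have "int (Suc n) * 1 \<le> int (Suc n) * \<bar>int (index s) - int (index t)\<bar>"
      by (intro mult_left_mono) auto
    also have "\<dots> = \<bar>int (Suc n) * (int (index s) - int (index t))\<bar>"
      by (simp only: abs_mult abs_of_nat)
    also have "int (Suc n) * (int (index s) - int (index t)) = N s - N t"
      unfolding N_def by (simp only: algebra_simps)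
    finally show ?thesis by simp
  qed
  let ?twist = "\<lambda>s. g [^]\<^bsub>G\<^esub> N s \<otimes>\<^bsub>G\<^esub> s \<otimes>\<^bsub>G\<^esub> g [^]\<^bsub>G\<^esub> N s"
  \<comment> \<open>A twisted generator equal to \<open>g\<close> is read as the letter \<open>g\<close>.\<close>
  let ?Y = "?twist ` (S - {\<one>\<^bsub>G\<^esub>}) - {g}"
  have "\<forall>t \<in> ?Y. \<exists>s. s \<in> S - {\<one>\<^bsub>G\<^esub>} \<and> t = ?twist s" by blast
  from bchoice[OF this] obtain \<sigma> where
    \<sigma>: "\<And>t. t \<in> ?Y \<Longrightarrow> \<sigma> t \<in> S - {\<one>\<^bsub>G\<^esub>}" "\<And>t. t \<in> ?Y \<Longrightarrow> t = ?twist (\<sigma> t)"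
    by blast
  interpret ping_pong G "topspace X" \<phi> g U ?Y \<sigma> "\<lambda>t. N (\<sigma> t)" n
  proof (intro ping_pong.intro ping_pong_axioms.intro)
    show "group_action G (topspace X) \<phi>" using act by (simp add: action_by_homeomorphisms_def)
    show "group G" by fact
    show "g \<in> carrier G" by fact
    show "g \<notin> ?Y" by simp
    show "U \<subseteq> topspace X" using openin_subset[OF U(1)] .
    show "\<phi> (g [^]\<^bsub>G\<^esub> a) x \<in> U" if "a \<noteq> 0" "x \<in> topspace X - U" for a :: int and x
      using that by (rule absorbs)
    fix t assume t: "t \<in> ?Y"
    show "\<sigma> t \<in> carrier G" using \<sigma>(1)[OF t] subS by blast
    show "\<phi> (\<sigma> t) u \<notin> U" if "u \<in> U" for u using U(4) \<sigma>(1)[OF t] that by blast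
    show "t = ?twist (\<sigma> t)" using \<sigma>(2)[OF t] .
    show "int n < N (\<sigma> t)" by (rule large)
    fix t' assume t': "t' \<in> ?Y" and neq: "t \<noteq> t'"
    have "\<sigma> t \<noteq> \<sigma> t'"
    proof
      assume "\<sigma> t = \<sigma> t'"
      then have "?twist (\<sigma> t) = ?twist (\<sigma> t')" by (rule arg_cong)
      from trans[OF \<sigma>(2)[OF t] trans[OF this \<sigma>(2)[OF t', symmetric]]] show False
        using neq by contradiction
    qed
    then show "int n < \<bar>N (\<sigma> t) - N (\<sigma> t')\<bar>"
      using \<sigma>(1)[OF t] \<sigma>(1)[OF t'] by (intro apart) blast+
  qed
  have z: "z \<in> topspace X - U" using xyz W U by auto
  have "insert g ?Y = insert g (?twist ` (S - {\<one>\<^bsub>G\<^esub>}))" by blast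
  then have "finite_generating_set G (insert g ?Y)"
    using generates_twisted[OF S g] by simp
  then show "\<exists>S. finite_generating_set G S \<and>
      (\<forall>w \<in> words S. w \<noteq> [] \<longrightarrow> reduced w \<longrightarrow> length w \<le> n \<longrightarrow> word_val G w \<noteq> \<one>\<^bsub>G\<^esub>)"
    using reduced_word_nontrivial[OF z] by (intro exI[of _ "insert g ?Y"]) auto
qed

end
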